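(* Let $F(z)=|z|^2L(z)+K(z)$ be in the class $L_{Lh}(\mathbb{D})$, where $L$ is logharmonic and $K$ is harmonic in $\mathbb{D}$, and suppose that $F(0)=\lambda_F(0)-1=0$, that $\Lambda_K(z)<\Lambda_1$ for all $z\in\mathbb{D}$, where $\Lambda_1>1$ is a constant, and that $\Lambda_L(z)\le\Lambda_2$ for all $z\in\mathbb{D}$, where $\Lambda_2$ is a constant. Then there exists a constant $0<r_1<1$ such that $F$ is univalent in the disk $|z|<r_1$; specifically, $r=r_1$ satisfies $$\Lambda_1\frac{1-\Lambda_1 r}{\Lambda_1-r}-3r^2\Lambda_2=0,$$ and $F(\mathbb{D}_{r_1})$ contains a schlicht disk $\mathbb{D}_{\rho_1}$, with $$\rho_1=\Lambda_1^2 r_1+(\Lambda_1^3-\Lambda_1)\ln\left(1-\frac{r_1}{\Lambda_1}\right)-r_1^3\Lambda_2.$$ Moreover, these estimates (both $r_1$ and $\rho_1$) are sharp, with an extremal function given by $$F_0(z)=\Lambda_1\int_{[0,z]}\frac{\frac{1}{\Lambda_1}-\zeta}{1-\frac{\zeta}{\Lambda_1}}\,d\zeta-\Lambda_2 z^2\overline{z}=\Lambda_1^2z+(\Lambda_1^3-\Lambda_1)\ln\left(1-\frac{z}{\Lambda_1}\right)-\Lambda_2 z^2\overline{z},\quad z\in\mathbb{D}.$$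
   Context: Notation: $\mathbb{D}_r=\{z\in\mathbb{C}:|z|<r\}$ for $r>0$, and $\mathbb{D}=\mathbb{D}_1$. Subscripts $z,\overline z$ denote the Wirtinger derivatives. For a continuously differentiable complex-valued function $f$ set $\Lambda_f(z)=|f_z(z)|+|f_{\overline z}(z)|$ and $\lambda_f(z)=\bigl||f_z(z)|-|f_{\overline z}(z)|\bigr|$. A function $f$ is harmonic if $\Delta f=4\frac{\partial^2 f}{\partial z\,\partial\overline z}=0$. A logharmonic function in $\mathbb{D}$ is a solution $f$ of the nonlinear elliptic equation $\overline{f_{\overline z}}/\overline f=a\,f_z/f$, where $a$ is analytic in $\mathbb{D}$ with $|a(z)|<1$ for $z\in\mathbb{D}$. $L_{Lh}(\mathbb{D})$ denotes the collection of all functions on $\mathbb{D}$ of the form $F(z)=|z|^2L(z)+K(z)$, where $L=h_1\overline{g_1}$ is logharmonic and $K=h_2+\overline{g_2}$ is harmonic in $\mathbb{D}$, with $h_1,g_1,h_2,g_2$ analytic in $\mathbb{D}$ (functions with logharmonic Laplacian). Univalent means injective. A schlicht disk is a disk which is the univalent image under the mapping in question of some region in $\mathbb{D}$. $[0,z]$ denotes the line segment from $0$ to $z$, and $\ln(1-z/\Lambda_1)$ is the principal branch. Sharpness with extremal function $F_0$ means that $F_0$ satisfies the hypotheses, $F_0$ is not univalent in $\mathbb{D}_r$ for any $r\in(r_1,1]$, and $F_0(\mathbb{D}_{r_1})$ contains no disk $\mathbb{D}_\rho$ with $\rho>\rho_1$.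
   Formalization: The formal theorem adds the hypothesis L(0)=0; without it the claim fails, e.g. for F(z)=c|z|^2+z with L=c, K(z)=z and c>1/r_1, where F(0)=F(-1/c)=0. *)

theory Defs
  imports "HOL-Complex_Analysis.Complex_Analysis"
begin

text \<open>
  The Wirtinger derivatives \<open>(f_x - i f_y)/2\<close> and \<open>(f_x + i f_y)/2\<close>, where \<open>f_x\<close> and \<open>f_y\<close> are
  the values of the real derivative of \<open>f\<close> in the directions \<open>1\<close> and \<open>\<i>\<close>. They are meaningful
  only where \<open>f\<close> is real-differentiable.
\<close>

definition dz :: "(complex \<Rightarrow> complex) \<Rightarrow> complex \<Rightarrow> complex" where
  "dz f z = (frechet_derivative f (at z) 1 - \<i> * frechet_derivative f (at z) \<i>) / 2"

definition dzbar :: "(complex \<Rightarrow> complex) \<Rightarrow> complex \<Rightarrow> complex" where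
  "dzbar f z = (frechet_derivative f (at z) 1 + \<i> * frechet_derivative f (at z) \<i>) / 2"

definition big_Lambda :: "(complex \<Rightarrow> complex) \<Rightarrow> complex \<Rightarrow> real" where
  "big_Lambda f z = norm (dz f z) + norm (dzbar f z)"

definition small_lambda :: "(complex \<Rightarrow> complex) \<Rightarrow> complex \<Rightarrow> real" where
  "small_lambda f z = \<bar>norm (dz f z) - norm (dzbar f z)\<bar>"

definition laplacian :: "(complex \<Rightarrow> complex) \<Rightarrow> complex \<Rightarrow> complex" where
  "laplacian f z = 4 * dz (dzbar f) z"

definition harmonic_on :: "(complex \<Rightarrow> complex) \<Rightarrow> complex set \<Rightarrow> bool" where
  "harmonic_on f S \<longleftrightarrow>
     (\<forall>z\<in>S. f differentiable at z \<and> dz f differentiable at z \<and> dzbar f differentiable at z) \<and>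
     (\<forall>z\<in>S. laplacian f z = 0)"

text \<open>
  The logharmonic equation is a quotient equation and is imposed where \<open>f\<close> does not vanish.
  The zero function, which is the function \<open>L\<close> of the extremal mapping when \<open>\<Lambda>\<^sub>2 = 0\<close>,
  therefore counts as logharmonic.
\<close>

definition logharmonic_on :: "(complex \<Rightarrow> complex) \<Rightarrow> complex set \<Rightarrow> bool" where
  "logharmonic_on f S \<longleftrightarrow>
     (\<forall>z\<in>S. f differentiable at z) \<and>
     (\<exists>a. a holomorphic_on S \<and> (\<forall>z\<in>S. norm (a z) < 1) \<and>
       (\<forall>z\<in>S. f z \<noteq> 0 \<longrightarrow> cnj (dzbar f z) / cnj (f z) = a z * dz f z / f z))"

text \<open>\<open>F\<close> belongs to the class \<open>L\<^sub>L\<^sub>h\<close> of the unit disk, with decomposition \<open>F = |z|\<^sup>2 L + K\<close>.\<close>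

definition logharmonic_laplacian ::
    "(complex \<Rightarrow> complex) \<Rightarrow> (complex \<Rightarrow> complex) \<Rightarrow> (complex \<Rightarrow> complex) \<Rightarrow> bool" where
  "logharmonic_laplacian F L K \<longleftrightarrow>
     logharmonic_on L (ball 0 1) \<and> harmonic_on K (ball 0 1) \<and>
     (\<exists>h\<^sub>1 g\<^sub>1 h\<^sub>2 g\<^sub>2.
        h\<^sub>1 holomorphic_on ball 0 1 \<and> g\<^sub>1 holomorphic_on ball 0 1 \<and>
        h\<^sub>2 holomorphic_on ball 0 1 \<and> g\<^sub>2 holomorphic_on ball 0 1 \<and>
        (\<forall>z\<in>ball 0 1. L z = h\<^sub>1 z * cnj (g\<^sub>1 z)) \<and>
        (\<forall>z\<in>ball 0 1. K z = h\<^sub>2 z + cnj (g\<^sub>2 z))) \<and>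
     (\<forall>z\<in>ball 0 1. F z = complex_of_real ((norm z)\<^sup>2) * L z + K z)"

text \<open>
  These conditions give \<open>K 0 = 0\<close> but not \<open>L 0 = 0\<close>. The estimate
  \<open>|L z| \<le> \<Lambda>\<^sub>2 |z|\<close>, which produces the term \<open>3 r\<^sup>2 \<Lambda>\<^sub>2\<close> in the equation for the radius,
  needs \<open>L 0 = 0\<close> as a separate hypothesis: for \<open>c > 0\<close> the mapping \<open>c |z|\<^sup>2 + z\<close>,
  with \<open>L\<close> constant and \<open>K\<close> the identity, satisfies them and takes the value \<open>0\<close> at
  both \<open>0\<close> and \<open>-1/c\<close>.
\<close>

definition landau_hypotheses ::
    "real \<Rightarrow> real \<Rightarrow> (complex \<Rightarrow> complex) \<Rightarrow> (complex \<Rightarrow> complex) \<Rightarrow> (complex \<Rightarrow> complex) \<Rightarrow> bool" where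
  "landau_hypotheses \<Lambda>\<^sub>1 \<Lambda>\<^sub>2 F L K \<longleftrightarrow>
     logharmonic_laplacian F L K \<and>
     F 0 = 0 \<and> small_lambda F 0 - 1 = 0 \<and>
     (\<forall>z\<in>ball 0 1. big_Lambda K z < \<Lambda>\<^sub>1) \<and>
     (\<forall>z\<in>ball 0 1. big_Lambda L z \<le> \<Lambda>\<^sub>2)"

text \<open>The image \<open>F ` S\<close> contains the disk \<open>D\<close> as a schlicht disk.\<close>

definition contains_schlicht_disk ::
    "(complex \<Rightarrow> complex) \<Rightarrow> complex set \<Rightarrow> complex set \<Rightarrow> bool" where
  "contains_schlicht_disk F S D \<longleftrightarrow>
     (\<exists>\<Omega>. \<Omega> \<subseteq> S \<and> open \<Omega> \<and> connected \<Omega> \<and> \<Omega> \<noteq> {} \<and> inj_on F \<Omega> \<and> F ` \<Omega> = D)"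

definition extremal :: "real \<Rightarrow> real \<Rightarrow> complex \<Rightarrow> complex" where
  "extremal \<Lambda>\<^sub>1 \<Lambda>\<^sub>2 z =
     of_real \<Lambda>\<^sub>1 * contour_integral (linepath 0 z)
       (\<lambda>\<zeta>. (1 / of_real \<Lambda>\<^sub>1 - \<zeta>) / (1 - \<zeta> / of_real \<Lambda>\<^sub>1))
     - of_real \<Lambda>\<^sub>2 * z\<^sup>2 * cnj z"

end

theory Submission
  imports Defs
begin

text \<open>
  Fix a direction \<open>v\<close> and write \<open>K = h + cnj g\<close>. For a suitable unimodular \<open>w\<close>, the function
  \<open>Re (w * D K z v)\<close> is the real part of a holomorphic function of \<open>z\<close> that is bounded by
  \<open>\<Lambda>\<^sub>1 |v|\<close> and has real part at least \<open>|v|\<close> at \<open>0\<close>; the Schwarz-Pick lemma bounds it below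
  by \<open>|v| \<Lambda>\<^sub>1 (1 - \<Lambda>\<^sub>1 |z|) / (\<Lambda>\<^sub>1 - |z|)\<close>. Since \<open>|L z| \<le> \<Lambda>\<^sub>2 |z|\<close>, the derivative of
  \<open>|z|\<^sup>2 L\<close> is at most \<open>3 |z|\<^sup>2 \<Lambda>\<^sub>2 |v|\<close>. As \<open>w\<close> does not depend on \<open>z\<close>, the mean value
  theorem along a chord gives injectivity on the closed disk of radius \<open>r\<^sub>1\<close>, and along a
  radius it gives \<open>|F z| \<ge> \<rho>\<^sub>1\<close> for \<open>|z| = r\<^sub>1\<close>, so the image contains the disk by
  connectedness. Both bounds are attained by the extremal mapping on the positive real axis.
\<close>

section \<open>Wirtinger calculus\<close>

lemma real_linear_wirtinger:
  fixes D :: "complex \<Rightarrow> complex"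
  assumes "linear D"
  shows "D v = (D 1 - \<i> * D \<i>) / 2 * v + (D 1 + \<i> * D \<i>) / 2 * cnj v"
proof -
  have "D v = D (Re v *\<^sub>R 1 + Im v *\<^sub>R \<i>)"
    by (rule arg_cong[of _ _ D]) (simp add: complex_eq_iff)
  also have "\<dots> = Re v *\<^sub>R D 1 + Im v *\<^sub>R D \<i>"
    by (simp only: linear_add[OF assms] linear_scale[OF assms])
  also have "\<dots> = (D 1 - \<i> * D \<i>) / 2 * v + (D 1 + \<i> * D \<i>) / 2 * cnj v"
    by (simp add: complex_eq_iff field_simps)
  finally show ?thesis .
qed

lemma has_derivative_wirtinger:
  assumes "f differentiable at z"
  shows "(f has_derivative (\<lambda>v. dz f z * v + dzbar f z * cnj v)) (at z)"
proof -
  let ?D = "frechet_derivative f (at z)"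
  have D: "(f has_derivative ?D) (at z)"
    using assms frechet_derivative_works by blast
  have "?D = (\<lambda>v. dz f z * v + dzbar f z * cnj v)"
    unfolding dz_def dzbar_def by (rule ext, rule real_linear_wirtinger[OF has_derivative_linear[OF D]])
  with D show ?thesis by simp
qed

lemma wirtinger_eqI:
  assumes "(f has_derivative (\<lambda>v. a * v + b * cnj v)) (at z)"
  shows "dz f z = a" and "dzbar f z = b"
proof -
  have "frechet_derivative f (at z) = (\<lambda>v. a * v + b * cnj v)"
    using assms frechet_derivative_at by metis
  then show "dz f z = a" "dzbar f z = b"
    by (simp_all add: dz_def dzbar_def algebra_simps)
qed

lemma norm_wirtinger_le: "norm (dz f z * v + dzbar f z * cnj v) \<le> big_Lambda f z * norm v"
  using norm_triangle_ineq[of "dz f z * v" "dzbar f z * cnj v"]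
  by (simp add: big_Lambda_def norm_mult algebra_simps)

section \<open>Schwarz-Pick bounds at a point\<close>

text \<open>Following \<open>f\<close> by the disk automorphism that takes \<open>a\<close> to 0 and
  applying the Schwarz lemma gives \<open>\<bar>x - a\<bar> \<le> r * (1 - a * x)\<close>; its lower
  half, solved for \<open>x\<close>, is the bound.\<close>

lemma schwarz_pick_real_point:
  fixes f :: "complex \<Rightarrow> complex" and a x r :: real
  assumes hol: "f holomorphic_on ball 0 1"
    and lt1: "\<And>z. norm z < 1 \<Longrightarrow> norm (f z) < 1"
    and f0: "f 0 = of_real a" and fr: "f (of_real r) = of_real x"
    and r: "0 \<le> r" "r < 1"
  shows "x \<ge> (a - r) / (1 - r * a)"
proof -
  define g where "g = Moebius_function 0 (of_real a) \<circ> f"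
  have a1: "\<bar>a\<bar> < 1" using lt1[of 0] f0 by simp
  have x1: "\<bar>x\<bar> < 1" using lt1[of "of_real r"] fr r by simp
  have "norm (g (of_real r)) \<le> norm (of_real r :: complex)"
  proof (rule Schwarz_Lemma(1))
    show "g holomorphic_on ball 0 1"
      unfolding g_def using a1 lt1
      by (intro holomorphic_on_compose_gen[OF hol, of _ "ball 0 1"] Moebius_function_holomorphic) auto
    show "g 0 = 0" by (simp add: g_def f0 Moebius_function_def)
    show "norm (g z) < 1" if "norm z < 1" for z
      unfolding g_def o_def using a1 lt1[OF that] by (intro Moebius_function_norm_lt_1) auto
  qed (use r in auto)
  moreover have "g (of_real r) = of_real ((x - a) / (1 - a * x))"
    by (simp add: g_def fr Moebius_function_def)
  ultimately have "\<bar>(x - a) / (1 - a * x)\<bar> \<le> r" using r by (simp only: norm_of_real)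
  moreover have pos: "1 - a * x > 0" "1 - r * a > 0"
  proof -
    have "\<bar>a * x\<bar> < 1" "\<bar>r * a\<bar> < 1"
      using a1 x1 r mult_strict_mono'[of "\<bar>a\<bar>" 1 "\<bar>x\<bar>" 1] mult_strict_mono'[of "\<bar>r\<bar>" 1 "\<bar>a\<bar>" 1]
      by (simp_all add: abs_mult)
    then show "1 - a * x > 0" "1 - r * a > 0" by linarith+
  qed
  ultimately have "a - x \<le> r * (1 - a * x)"
    by (simp add: abs_le_iff minus_divide_left pos_divide_le_eq)
  then show ?thesis using pos by (simp add: pos_divide_le_eq algebra_simps)
qed

text \<open>
  Averaging \<open>f\<close> with its reflection across the line through \<open>0\<close> and \<open>z\<close> replaces the
  values at \<open>0\<close> and \<open>z\<close> by their real parts.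
\<close>

lemma schwarz_pick_Re_ge:
  fixes f :: "complex \<Rightarrow> complex"
  assumes hol: "f holomorphic_on ball 0 1"
    and lt1: "\<And>z. norm z < 1 \<Longrightarrow> norm (f z) < 1"
    and z: "norm z < 1" and \<alpha>: "\<alpha> \<le> Re (f 0)"
    and \<alpha>0: "0 \<le> \<alpha>"
  shows "Re (f z) \<ge> (\<alpha> - norm z) / (1 - norm z * \<alpha>)"
proof -
  define u where "u = cis (Arg z)"
  have u: "norm u = 1" by (simp add: u_def)
  have zu: "z = of_real (norm z) * u" unfolding u_def by (metis rcis_cmod_Arg rcis_def)
  \<comment> \<open>Precomposing \<open>f\<close> with the rotation by \<open>u\<close> replaces
    \<open>z\<close> by the real point \<open>norm z\<close>, and the reflection becomes
    conjugation.\<close>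
  define h where "h = (\<lambda>\<zeta>. f (u * \<zeta>))"
  define g where "g = (\<lambda>\<zeta>. (h \<zeta> + (cnj \<circ> h \<circ> cnj) \<zeta>) / 2)"
  have h1: "norm (h \<zeta>) < 1" if "norm \<zeta> < 1" for \<zeta>
    unfolding h_def using that u by (intro lt1) (simp add: norm_mult)
  have holh: "h holomorphic_on ball 0 1"
    unfolding h_def using u
    by (intro holomorphic_on_compose_gen[OF _ hol, unfolded o_def] holomorphic_intros)
       (auto simp: norm_mult)
  have "cnj ` ball 0 1 = ball 0 1"
    by (auto simp: image_cnj_conv_vimage_cnj)
  then have holg: "g holomorphic_on ball 0 1"
    unfolding g_def using holh
    by (intro holomorphic_intros holomorphic_on_compose_cnj_cnj) auto
  define r where "r = norm z"
  have r: "0 \<le> r" "r < 1" using z by (auto simp: r_def)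
  have "Re (f z) \<ge> (Re (f 0) - r) / (1 - r * Re (f 0))"
  proof (rule schwarz_pick_real_point[OF holg])
    show "norm (g \<zeta>) < 1" if "norm \<zeta> < 1" for \<zeta>
    proof -
      have "norm (h \<zeta> + cnj (h (cnj \<zeta>))) \<le> norm (h \<zeta>) + norm (h (cnj \<zeta>))"
        using norm_triangle_ineq[of "h \<zeta>" "cnj (h (cnj \<zeta>))"] by simp
      then show ?thesis using h1[of \<zeta>] h1[of "cnj \<zeta>"] that by (simp add: g_def norm_divide)
    qed
    show "g 0 = of_real (Re (f 0))" by (simp add: g_def h_def complex_eq_iff)
    have "h (of_real r) = f z" using zu by (metis h_def r_def mult.commute)
    then show "g (of_real r) = of_real (Re (f z))" by (simp add: g_def complex_eq_iff)
  qed (use r in auto)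
  \<comment> \<open>The bound increases with the value at 0: over a common denominator the two sides
    differ by \<open>(Re (f 0) - \<alpha>) * (1 - r * r)\<close>.\<close>
  moreover have "(\<alpha> - r) / (1 - r * \<alpha>) \<le> (Re (f 0) - r) / (1 - r * Re (f 0))"
  proof -
    have a1: "Re (f 0) < 1"
      using lt1[of 0] complex_Re_le_cmod[of "f 0"] by simp
    have "r * Re (f 0) \<le> r" "r * \<alpha> \<le> r"
      using r a1 \<alpha> mult_left_mono[of "Re (f 0)" 1 r] mult_left_mono[of \<alpha> 1 r] by auto
    then have "1 - r * Re (f 0) > 0" "1 - r * \<alpha> > 0" using r by linarith+
    moreover have "(Re (f 0) - \<alpha>) * (1 - r * r) \<ge> 0"
      using r \<alpha> mult_mono[of r 1 r 1] by (intro mult_nonneg_nonneg) auto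
    ultimately show ?thesis by (simp add: field_simps)
  qed
  ultimately show ?thesis by (simp add: r_def)
qed

section \<open>Radial comparison functions\<close>

text \<open>The Schwarz-Pick bound \<open>A * ((1 / A - t) / (1 - t / A))\<close>, with inner
  fractions cleared, for a holomorphic function of modulus below \<open>A\<close> whose real part at
  0 is at least 1.\<close>

definition slope :: "real \<Rightarrow> real \<Rightarrow> real" where
  "slope A t = A * ((1 - A * t) / (A - t))"

text \<open>Antiderivative of \<open>slope A\<close> that vanishes at 0.\<close>

definition profile :: "real \<Rightarrow> real \<Rightarrow> real" where
  "profile A t = A\<^sup>2 * t + (A ^ 3 - A) * ln (1 - t / A)"

lemma profile_has_derivative:
  assumes "A > 1" "t < A"
  shows "(profile A has_real_derivative slope A t) (at t)"
proof -
  have "((\<lambda>t. ln (1 - t / A)) has_real_derivative - 1 / (A - t)) (at t)"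
    using assms by (auto intro!: derivative_eq_intros simp: field_simps)
  then have "(profile A has_real_derivative A\<^sup>2 + (A ^ 3 - A) * (- 1 / (A - t))) (at t)"
    unfolding profile_def[abs_def] by (intro derivative_intros DERIV_cmult DERIV_cmult_Id)
  also have "A\<^sup>2 + (A ^ 3 - A) * (- 1 / (A - t)) = slope A t"
    using assms by (simp add: slope_def divide_simps) (simp add: algebra_simps power2_eq_square power3_eq_cube)
  finally show ?thesis .
qed

text \<open>After cross-multiplication the two sides differ by \<open>(A * A - 1) * (t - s)\<close>,
  which is positive.\<close>

lemma slope_strict_decreasing:
  assumes "A > 1" "s < t" "t < A"
  shows "slope A t < slope A s"
proof -
  have "(A * A - 1) * (t - s) > 0" using assms
    by (intro mult_pos_pos) (auto simp: less_1_mult)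
  then have "(1 - A * t) * (A - s) < (1 - A * s) * (A - t)" by (simp add: algebra_simps)
  then show ?thesis using assms by (simp add: slope_def divide_simps)
qed

text \<open>Lower bound, per unit length and after rotation, for the derivative of \<open>F\<close>
  at distance \<open>t\<close> from 0: the subtracted term is the most that |z|^2 L can take away.
  Its zero is the radius of univalence.\<close>

definition net_slope :: "real \<Rightarrow> real \<Rightarrow> real \<Rightarrow> real" where
  "net_slope A B t = slope A t - 3 * t\<^sup>2 * B"

lemma net_slope_strict_decreasing:
  assumes "A > 1" "B \<ge> 0" "0 \<le> s" "s < t" "t < A"
  shows "net_slope A B t < net_slope A B s"
proof -
  have "s\<^sup>2 * B \<le> t\<^sup>2 * B" using assms by (intro mult_right_mono power_mono) auto
  then show ?thesis using slope_strict_decreasing[of A s t] assms by (simp add: net_slope_def)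
qed

lemma net_profile_has_derivative:
  assumes "A > 1" "t < A"
  shows "((\<lambda>t. profile A t - t ^ 3 * B) has_real_derivative net_slope A B t) (at t)"
  unfolding net_slope_def
  by (rule DERIV_diff[OF profile_has_derivative[OF assms]]) (auto intro!: derivative_eq_intros)

text \<open>Intermediate value theorem: the value is 1 at 0 and \<open>- A - 3 * B\<close> at
  1.\<close>

lemma net_slope_zero:
  assumes "A > 1" "B \<ge> 0"
  obtains r where "0 < r" "r < 1" "net_slope A B r = 0"
proof -
  have ends: "net_slope A B 1 < 0" "net_slope A B 0 > 0"
  proof -
    have "slope A 1 = - A" using assms by (simp add: slope_def field_simps)
    then show "net_slope A B 1 < 0" "net_slope A B 0 > 0"
      using assms by (auto simp: net_slope_def slope_def)
  qed
  have "\<exists>r. 0 \<le> r \<and> r \<le> 1 \<and> net_slope A B r = 0"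
  proof (rule IVT2')
    show "continuous_on {0..1} (net_slope A B)"
      unfolding net_slope_def slope_def using assms by (intro continuous_intros) auto
  qed (use ends in auto)
  with ends that show ?thesis by (metis order_less_le order_less_irrefl)
qed

section \<open>Directional derivatives of harmonic mappings\<close>

lemma has_derivative_holomorphic_add_cnj:
  assumes h: "h holomorphic_on S" and g: "g holomorphic_on S" and S: "open S" "z \<in> S"
    and K: "\<And>z. z \<in> S \<Longrightarrow> K z = h z + cnj (g z)"
  shows "(K has_derivative (\<lambda>v. deriv h z * v + cnj (deriv g z) * cnj v)) (at z)"
proof -
  have "(h has_derivative (\<lambda>v. deriv h z * v)) (at z)" "(g has_derivative (\<lambda>v. deriv g z * v)) (at z)"
    using holomorphic_derivI[OF h S] holomorphic_derivI[OF g S] by (auto simp: has_field_derivative_def)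
  then have "((\<lambda>z. h z + cnj (g z)) has_derivative (\<lambda>v. deriv h z * v + cnj (deriv g z * v))) (at z)"
    by (intro has_derivative_add has_derivative_cnj)
  then have "(K has_derivative (\<lambda>v. deriv h z * v + cnj (deriv g z * v))) (at z)"
    by (rule has_derivative_transform_within_open[OF _ S]) (simp add: K)
  then show ?thesis by simp
qed

text \<open>The rotation \<open>w\<close> depends on the direction \<open>v\<close> but not on
  \<open>z\<close>, so the bound can be integrated along segments parallel to
  \<open>v\<close>.\<close>

lemma harmonic_directional_lower_bound:
  fixes h g K :: "complex \<Rightarrow> complex"
  assumes A: "A > 1"
    and h: "h holomorphic_on ball 0 1" and g: "g holomorphic_on ball 0 1"
    and K: "\<And>z. z \<in> ball 0 1 \<Longrightarrow> K z = h z + cnj (g z)"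
    and bound: "\<And>z. z \<in> ball 0 1 \<Longrightarrow> big_Lambda K z < A"
    and small: "small_lambda K 0 = 1"
    and v: "v \<noteq> 0"
  obtains w where "norm w = 1"
    "\<And>z. z \<in> ball 0 1 \<Longrightarrow> norm v * slope A (norm z) \<le> Re (w * (dz K z * v + dzbar K z * cnj v))"
proof -
  have wK: "dz K z = deriv h z" "dzbar K z = cnj (deriv g z)" if "z \<in> ball 0 1" for z
    using wirtinger_eqI[OF has_derivative_holomorphic_add_cnj[OF h g open_ball that K]] by auto
  define d where "d = dz K 0 * v + dzbar K 0 * cnj v"
  \<comment> \<open>The condition at 0 says, by the reverse triangle inequality, that the derivative
    of \<open>K\<close> there shrinks no vector.\<close>
  have "norm v = \<bar>norm (dz K 0 * v) - norm (dzbar K 0 * cnj v)\<bar>"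
    using small unfolding small_lambda_def
    by (simp add: norm_mult abs_mult flip: left_diff_distrib)
  also have "\<dots> \<le> norm d"
    unfolding d_def using norm_triangle_ineq3[of "dz K 0 * v" "- (dzbar K 0 * cnj v)"] by simp
  finally have d: "norm v \<le> norm d" .
  with v have d0: "d \<noteq> 0" by auto
  \<comment> \<open>Rotates \<open>d\<close>, the derivative at 0 in direction \<open>v\<close>,
    onto the positive real axis.\<close>
  define w where "w = cnj (sgn d)"
  have w: "norm w = 1" using d0 by (simp add: w_def norm_sgn)
  have wd: "Re (w * d) = norm d"
    using d0 by (simp add: w_def sgn_eq complex_norm_square[symmetric] power2_eq_square mult.commute[of _ d]
      flip: of_real_mult)
  \<comment> \<open>Conjugating \<open>w * (dzbar K z * cnj v)\<close> keeps its real part and makes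
    it holomorphic in \<open>z\<close>; dividing by \<open>norm v * A\<close> brings the modulus
    below 1.\<close>
  define \<phi> where "\<phi> = (\<lambda>z. (w * v * deriv h z + cnj w * v * deriv g z) / of_real (norm v * A))"
  have vA: "norm v * A > 0" using v A by simp
  have Re\<phi>: "Re (\<phi> z) = Re (w * (dz K z * v + dzbar K z * cnj v)) / (norm v * A)" if "z \<in> ball 0 1" for z
  proof -
    have "Re (cnj w * v * deriv g z) = Re (cnj (cnj w * v * deriv g z))" by (simp only: cnj.sel)
    also have "\<dots> = Re (w * (dzbar K z * cnj v))" by (simp add: wK[OF that] mult_ac)
    finally show ?thesis by (simp only: \<phi>_def Re_divide_of_real wK(1)[OF that] plus_complex.sel ring_distribs)
       (simp add: mult_ac)
  qed
  show ?thesis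
  proof
    fix z :: complex assume z: "z \<in> ball 0 1"
    have "(1 / A - norm z) / (1 - norm z * (1 / A)) \<le> Re (\<phi> z)"
    proof (rule schwarz_pick_Re_ge)
      show "\<phi> holomorphic_on ball 0 1"
        unfolding \<phi>_def using vA by (intro holomorphic_intros h g) auto
      show "norm (\<phi> \<zeta>) < 1" if "norm \<zeta> < 1" for \<zeta>
      proof -
        have \<zeta>: "\<zeta> \<in> ball 0 1" using that by simp
        have "norm (w * v * deriv h \<zeta> + cnj w * v * deriv g \<zeta>) \<le> norm v * big_Lambda K \<zeta>"
          unfolding big_Lambda_def wK[OF \<zeta>]
          by (rule norm_triangle_le) (simp add: norm_mult w algebra_simps)
        also have "\<dots> < norm v * A" using bound[OF \<zeta>] v by simp
        finally show ?thesis
          using v A by (simp add: \<phi>_def norm_divide norm_mult pos_divide_less_eq)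
      qed
      show "1 / A \<le> Re (\<phi> 0)"
        using d vA v A wd by (simp add: Re\<phi> flip: d_def) (simp add: field_simps)
    qed (use z A in auto)
    then have "norm v * A * ((1 / A - norm z) / (1 - norm z * (1 / A))) \<le> norm v * A * Re (\<phi> z)"
      using vA by (intro mult_left_mono) auto
    moreover have "A * ((1 / A - norm z) / (1 - norm z * (1 / A))) = slope A (norm z)"
      using A z by (simp add: slope_def divide_simps)
    moreover have "norm v * A * Re (\<phi> z) = Re (w * (dz K z * v + dzbar K z * cnj v))"
      using v A by (simp only: Re\<phi>[OF z]) simp
    ultimately show "norm v * slope A (norm z) \<le> Re (w * (dz K z * v + dzbar K z * cnj v))"
      by (simp only: mult.assoc)
  qed (rule w)
qed

section \<open>Derivative estimates under the Landau hypotheses\<close>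

locale landau =
  fixes A B :: real and F L K :: "complex \<Rightarrow> complex"
  assumes A: "A > 1" and hyps: "landau_hypotheses A B F L K" and L0: "L 0 = 0"
begin

lemma F_eq: "z \<in> ball 0 1 \<Longrightarrow> F z = of_real ((norm z)\<^sup>2) * L z + K z"
  using hyps by (simp add: landau_hypotheses_def logharmonic_laplacian_def)

lemma K_decomposition:
  obtains h g where "h holomorphic_on ball 0 1" "g holomorphic_on ball 0 1"
    "\<And>z. z \<in> ball 0 1 \<Longrightarrow> K z = h z + cnj (g z)"
  using hyps by (auto simp: landau_hypotheses_def logharmonic_laplacian_def)

lemma L_has_derivative:
  "z \<in> ball 0 1 \<Longrightarrow> (L has_derivative (\<lambda>v. dz L z * v + dzbar L z * cnj v)) (at z)"
  using hyps by (intro has_derivative_wirtinger)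
    (simp add: landau_hypotheses_def logharmonic_laplacian_def logharmonic_on_def)

lemma K_has_derivative:
  "z \<in> ball 0 1 \<Longrightarrow> (K has_derivative (\<lambda>v. dz K z * v + dzbar K z * cnj v)) (at z)"
  using hyps by (intro has_derivative_wirtinger)
    (simp add: landau_hypotheses_def logharmonic_laplacian_def harmonic_on_def)

lemma big_Lambda_K: "z \<in> ball 0 1 \<Longrightarrow> big_Lambda K z < A"
  and big_Lambda_L: "z \<in> ball 0 1 \<Longrightarrow> big_Lambda L z \<le> B"
  using hyps by (auto simp: landau_hypotheses_def)

lemma B_nonneg: "B \<ge> 0"
  using big_Lambda_L[of 0] by (simp add: big_Lambda_def) (meson add_nonneg_nonneg norm_ge_zero order_trans)

lemma K0: "K 0 = 0"
  using hyps F_eq[of 0] by (simp add: landau_hypotheses_def)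

text \<open>\<open>big_Lambda L\<close> bounds the operator norm of the derivative of
  \<open>L\<close>, so the mean value inequality applies on the convex disk; the vanishing of
  \<open>L\<close> at 0 removes the constant term.\<close>

lemma norm_L_le:
  assumes "z \<in> ball 0 1"
  shows "norm (L z) \<le> B * norm z"
proof -
  have "norm (L z - L 0) \<le> B * norm (z - 0)"
  proof (rule differentiable_bound[of "ball 0 1" _ "\<lambda>z v. dz L z * v + dzbar L z * cnj v"])
    show "onorm (\<lambda>v. dz L x * v + dzbar L x * cnj v) \<le> B" if "x \<in> ball 0 1" for x
    proof (rule onorm_le)
      fix v
      have "norm (dz L x * v + dzbar L x * cnj v) \<le> big_Lambda L x * norm v" by (rule norm_wirtinger_le)
      also have "\<dots> \<le> B * norm v" using big_Lambda_L[OF that] by (intro mult_right_mono) auto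
      finally show "norm (dz L x * v + dzbar L x * cnj v) \<le> B * norm v" .
    qed
  qed (use assms in \<open>auto intro: has_derivative_at_withinI[OF L_has_derivative]\<close>)
  then show ?thesis by (simp add: L0)
qed

definition d_norm_sq_L :: "complex \<Rightarrow> complex \<Rightarrow> complex" where
  "d_norm_sq_L z v = of_real (2 * (z \<bullet> v)) * L z + of_real ((norm z)\<^sup>2) * (dz L z * v + dzbar L z * cnj v)"

definition dF :: "complex \<Rightarrow> complex \<Rightarrow> complex" where
  "dF z v = d_norm_sq_L z v + (dz K z * v + dzbar K z * cnj v)"

lemma F_has_derivative:
  assumes "z \<in> ball 0 1"
  shows "(F has_derivative dF z) (at z)"
proof -
  \<comment> \<open>Written as an inner product, the squared norm falls under the product rule at
    every point, 0 included.\<close>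
  have "((\<lambda>z. of_real (z \<bullet> z) * L z + K z) has_derivative dF z) (at z)"
    by (rule derivative_eq_intros L_has_derivative[OF assms] K_has_derivative[OF assms] refl ext)+
       (simp add: dF_def d_norm_sq_L_def power2_norm_eq_inner inner_commute algebra_simps)
  then show ?thesis
    by (rule has_derivative_transform_within_open[of _ _ _ _ "ball 0 1"])
       (use assms in \<open>auto simp: F_eq power2_norm_eq_inner\<close>)
qed

text \<open>The factor 3 is 2 + 1: differentiating the squared norm contributes at most
  \<open>2 * (norm z)\<^sup>2 * B\<close>, because \<open>norm (L z) \<le> B * norm z\<close>, and
  differentiating \<open>L\<close> at most \<open>(norm z)\<^sup>2 * B\<close>.\<close>

lemma norm_d_norm_sq_L_le:
  assumes "z \<in> ball 0 1"
  shows "norm (d_norm_sq_L z v) \<le> norm v * (3 * (norm z)\<^sup>2 * B)"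
proof -
  have "norm (of_real (2 * (z \<bullet> v)) * L z) \<le> 2 * (norm z * norm v) * (B * norm z)"
    unfolding norm_mult norm_of_real using Cauchy_Schwarz_ineq2[of z v] norm_L_le[OF assms]
    by (intro mult_mono) (auto simp: abs_mult)
  moreover have "norm (of_real ((norm z)\<^sup>2) * (dz L z * v + dzbar L z * cnj v)) \<le> (norm z)\<^sup>2 * (B * norm v)"
    unfolding norm_mult norm_of_real using big_Lambda_L[OF assms]
    by (intro mult_mono order_trans[OF norm_wirtinger_le] mult_right_mono) auto
  ultimately show ?thesis
    unfolding d_norm_sq_L_def by (intro norm_triangle_le) (simp add: power2_eq_square algebra_simps)
qed

text \<open>The derivative of |z|^2 L vanishes at 0, so \<open>F\<close> and \<open>K\<close> have
  the same Wirtinger derivatives there.\<close>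

lemma small_lambda_K: "small_lambda K 0 = 1"
proof -
  have "dF 0 = (\<lambda>v. dz K 0 * v + dzbar K 0 * cnj v)" by (simp add: dF_def d_norm_sq_L_def fun_eq_iff)
  then have "dz F 0 = dz K 0" "dzbar F 0 = dzbar K 0"
    using wirtinger_eqI F_has_derivative[of 0] by (metis centre_in_ball zero_less_one)+
  then show ?thesis using hyps by (simp add: landau_hypotheses_def small_lambda_def)
qed

text \<open>Kept apart from the bound for \<open>F\<close> because the growth estimate
  \<open>norm_F_ge\<close> integrates the derivative of \<open>K\<close> alone.\<close>

lemma K_directional_lower_bound:
  assumes "v \<noteq> 0"
  obtains w where "norm w = 1"
    "\<And>z. z \<in> ball 0 1 \<Longrightarrow> norm v * slope A (norm z) \<le> Re (w * (dz K z * v + dzbar K z * cnj v))"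
proof -
  obtain h g where "h holomorphic_on ball 0 1" "g holomorphic_on ball 0 1"
    "\<And>z. z \<in> ball 0 1 \<Longrightarrow> K z = h z + cnj (g z)"
    using K_decomposition by blast
  from harmonic_directional_lower_bound[OF A this big_Lambda_K small_lambda_K assms] that
  show ?thesis by blast
qed

lemma F_directional_lower_bound:
  assumes "v \<noteq> 0"
  obtains w where "norm w = 1"
    "\<And>z. z \<in> ball 0 1 \<Longrightarrow> norm v * net_slope A B (norm z) \<le> Re (w * dF z v)"
proof -
  obtain w where w: "norm w = 1"
    and K: "\<And>z. z \<in> ball 0 1 \<Longrightarrow> norm v * slope A (norm z) \<le> Re (w * (dz K z * v + dzbar K z * cnj v))"
    using K_directional_lower_bound[OF assms] by blast
  show ?thesis
  proof
    fix z :: complex assume z: "z \<in> ball 0 1"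
    have "- Re (w * d_norm_sq_L z v) \<le> norm (w * d_norm_sq_L z v)"
      using abs_Re_le_cmod[of "w * d_norm_sq_L z v"] by linarith
    also have "\<dots> \<le> norm v * (3 * (norm z)\<^sup>2 * B)"
      using norm_d_norm_sq_L_le[OF z] w by (simp add: norm_mult)
    finally show "norm v * net_slope A B (norm z) \<le> Re (w * dF z v)"
      using K[OF z] unfolding dF_def net_slope_def ring_distribs plus_complex.sel right_diff_distrib by linarith
  qed (rule w)
qed

end

section \<open>Sign of the net slope, and restriction to lines\<close>

lemma net_slope_pos:
  assumes "A > 1" "B \<ge> 0" "r < 1" "net_slope A B r = 0" "0 \<le> t" "t < r"
  shows "net_slope A B t > 0"
  using net_slope_strict_decreasing[of A B t r] assms by simp

text \<open>The function vanishes at 0 and its derivative \<open>net_slope A B\<close> is positive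
  strictly between 0 and \<open>r\<close>; the zero of the derivative at \<open>r\<close> itself
  does no harm.\<close>

lemma net_profile_pos:
  assumes "A > 1" "B \<ge> 0" "0 < r" "r < 1" "net_slope A B r = 0"
  shows "profile A r - r ^ 3 * B > 0"
proof -
  have "profile A 0 - 0 ^ 3 * B < profile A r - r ^ 3 * B"
  proof (rule DERIV_pos_imp_increasing_open[of 0 r "\<lambda>t. profile A t - t ^ 3 * B"])
    show "continuous_on {0..r} (\<lambda>t. profile A t - t ^ 3 * B)"
      by (rule DERIV_atLeastAtMost_imp_continuous_on, rule exI, rule net_profile_has_derivative)
        (use assms in auto)
    show "\<exists>y. ((\<lambda>t. profile A t - t ^ 3 * B) has_real_derivative y) (at t) \<and> 0 < y"
      if "0 < t" "t < r" for t
      using that assms net_profile_has_derivative[of A t B] net_slope_pos[of A B r t] by auto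
  qed (use assms in auto)
  then show ?thesis by (simp add: profile_def)
qed

lemma has_real_derivative_Re_along_line:
  assumes "(f has_derivative D) (at (x + t *\<^sub>R v))"
  shows "((\<lambda>t. Re (w * f (x + t *\<^sub>R v))) has_real_derivative Re (w * D v)) (at t)"
proof -
  have "((\<lambda>t. x + t *\<^sub>R v) has_derivative (\<lambda>s. s *\<^sub>R v)) (at t)"
    by (auto intro!: derivative_eq_intros)
  from has_derivative_compose[OF this assms]
  have "((\<lambda>t. Re (w * f (x + t *\<^sub>R v))) has_derivative (\<lambda>s. Re (w * D (s *\<^sub>R v)))) (at t)"
    by (intro has_derivative_Re has_derivative_mult_right)
  also have "(\<lambda>s. Re (w * D (s *\<^sub>R v))) = (*) (Re (w * D v))"
    using linear_scale[OF has_derivative_linear[OF assms]] by (auto simp: mult.commute)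
  finally show ?thesis by (simp add: has_field_derivative_def)
qed

section \<open>Univalence and the schlicht disk\<close>

context landau
begin

text \<open>The closed disk, rather than the open one, serves the sharpness of the covering radius,
  where a boundary point is compared with interior points.\<close>

lemma inj_on_cball:
  assumes r: "r < 1" "net_slope A B r = 0"
  shows "inj_on F (cball 0 r)"
proof (rule inj_onI, rule ccontr)
  fix x y assume xy: "x \<in> cball 0 r" "y \<in> cball 0 r" and eq: "F x = F y" and ne: "x \<noteq> y"
  have v: "y - x \<noteq> 0" using ne by simp
  obtain w where
    w: "\<And>z. z \<in> ball 0 1 \<Longrightarrow> norm (y - x) * net_slope A B (norm z) \<le> Re (w * dF z (y - x))"
    using F_directional_lower_bound[OF v] by blast
  let ?p = "\<lambda>t. x + t *\<^sub>R (y - x)"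
  have p: "?p t = (1 - t) *\<^sub>R x + t *\<^sub>R y" for t by (simp add: algebra_simps)
  have seg: "?p t \<in> ball 0 1" if "0 \<le> t" "t \<le> 1" for t
  proof -
    have "?p t \<in> cball 0 r"
      unfolding p using xy that by (intro convexD[OF convex_cball]) auto
    then show ?thesis using r by simp
  qed
  obtain t where t: "0 < t" "t < 1" and
    "Re (w * F (?p 1)) - Re (w * F (?p 0)) = (1 - 0) * Re (w * dF (?p t) (y - x))"
    using MVT2[of 0 1 "\<lambda>t. Re (w * F (?p t))" "\<lambda>t. Re (w * dF (?p t) (y - x))"]
      has_real_derivative_Re_along_line[OF F_has_derivative[OF seg]] by auto
  then have "Re (w * dF (?p t) (y - x)) = 0" using eq by simp
  \<comment> \<open>Interior points of a chord lie strictly inside the disk even when both ends are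
    on the circle, so the net slope is strictly positive there.\<close>
  moreover have "norm (?p t) < r"
  proof -
    have "?p t \<in> open_segment x y" using t ne p by (auto simp: in_segment)
    from dist_decreases_open_segment[OF this, of 0] show ?thesis
      using xy unfolding dist_0_norm mem_cball by linarith
  qed
  then have "norm (y - x) * net_slope A B (norm (?p t)) > 0"
    using v A B_nonneg r by (intro mult_pos_pos net_slope_pos) auto
  ultimately show False using w[OF seg[of t]] t by auto
qed

text \<open>The bound for the derivative of \<open>K\<close> in the radial direction integrates to
  \<open>profile A\<close>; then \<open>norm (L z) \<le> B * norm z\<close> takes away at most
  \<open>B * norm z ^ 3\<close>.\<close>

lemma norm_F_ge:
  assumes z: "z \<in> ball 0 1"
  shows "profile A (norm z) - norm z ^ 3 * B \<le> norm (F z)"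
proof (cases "z = 0")
  case True
  then show ?thesis by (simp add: profile_def)
next
  case False
  obtain w where w: "norm w = 1" and
    K: "\<And>\<zeta>. \<zeta> \<in> ball 0 1 \<Longrightarrow> norm z * slope A (norm \<zeta>) \<le> Re (w * (dz K \<zeta> * z + dzbar K \<zeta> * cnj z))"
    using K_directional_lower_bound[OF False] by blast
  \<comment> \<open>Nondecreasing and zero at 0; the spelling \<open>0 + t *\<^sub>R z\<close>
    matches the lemma on derivatives along a line.\<close>
  let ?f = "\<lambda>t. Re (w * K (0 + t *\<^sub>R z)) - profile A (t * norm z)"
  have "?f 0 \<le> ?f 1"
  proof (rule DERIV_nonneg_imp_nondecreasing[of 0 1 ?f])
    fix t :: real assume t: "0 \<le> t" "t \<le> 1"
    have le: "t * norm z \<le> norm z" using t by (simp add: mult_left_le_one_le)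
    with z t have tz: "0 + t *\<^sub>R z \<in> ball 0 1" "t * norm z < A" using A by auto
    have "(profile A \<circ> (\<lambda>t. t * norm z) has_real_derivative slope A (t * norm z) * norm z) (at t)"
      using A tz(2) by (intro DERIV_chain profile_has_derivative) (auto intro!: derivative_eq_intros)
    then have "(?f has_real_derivative
        Re (w * (dz K (0 + t *\<^sub>R z) * z + dzbar K (0 + t *\<^sub>R z) * cnj z)) - slope A (t * norm z) * norm z) (at t)"
      unfolding o_def by (intro DERIV_diff has_real_derivative_Re_along_line[OF K_has_derivative[OF tz(1)]])
    moreover have "norm (0 + t *\<^sub>R z) = t * norm z" using t by simp
    ultimately show "\<exists>y. (?f has_real_derivative y) (at t) \<and> 0 \<le> y"
      using K[OF tz(1)] by (auto simp: mult.commute)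
  qed simp
  then have "profile A (norm z) \<le> Re (w * K z)" by (simp add: K0 profile_def)
  also have "\<dots> \<le> norm (K z)" using complex_Re_le_cmod[of "w * K z"] w by (simp add: norm_mult)
  also have "K z = F z - of_real ((norm z)\<^sup>2) * L z" using F_eq[OF z] by simp
  also have "norm \<dots> \<le> norm (F z) + (norm z)\<^sup>2 * norm (L z)"
    using norm_triangle_ineq4[of "F z" "of_real ((norm z)\<^sup>2) * L z"] by (simp add: norm_mult norm_power)
  also have "(norm z)\<^sup>2 * norm (L z) \<le> (norm z)\<^sup>2 * (B * norm z)"
    by (intro mult_left_mono norm_L_le z) auto
  finally show ?thesis by (simp add: power2_eq_square power3_eq_cube mult_ac)
qed

text \<open>The images of the open and the closed disk of radius \<open>r\<close> agree inside the
  target disk, since the circle is mapped outside it. One is open by invariance of domain and the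
  other compact, so their common trace is clopen in a connected set; it contains 0, hence is
  everything.\<close>

lemma schlicht_disk:
  assumes r: "0 < r" "r < 1" "net_slope A B r = 0"
  shows "contains_schlicht_disk F (ball 0 r) (ball 0 (profile A r - r ^ 3 * B))"
proof -
  define \<rho> where "\<rho> = profile A r - r ^ 3 * B"
  have \<rho>: "\<rho> > 0" unfolding \<rho>_def using net_profile_pos A B_nonneg r by blast
  have inj: "inj_on F (ball 0 r)"
    using inj_on_cball[OF r(2,3)] by (rule inj_on_subset) auto
  have "continuous_on (ball 0 1) F"
    using F_has_derivative has_derivative_continuous continuous_at_imp_continuous_on by blast
  then have cont: "continuous_on (cball 0 r) F" "continuous_on (ball 0 r) F"
    by (rule continuous_on_subset; use r in auto)+
  have clopen: "ball 0 \<rho> \<inter> F ` ball 0 r = ball 0 \<rho> \<inter> F ` cball 0 r"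
  proof -
    have "F z \<notin> ball 0 \<rho>" if "norm z = r" for z
      using norm_F_ge[of z] that r by (auto simp: \<rho>_def)
    then show ?thesis by (auto simp: order_le_less)
  qed
  have "open (F ` ball 0 r)"
    using cont inj by (intro invariance_of_domain) auto
  moreover have "closed (F ` cball 0 r)"
    by (intro compact_imp_closed compact_continuous_image cont compact_cball)
  ultimately have "ball 0 \<rho> \<inter> F ` ball 0 r = {} \<or> ball 0 \<rho> \<inter> F ` ball 0 r = ball 0 \<rho>"
    using connected_ball[of "0::complex" \<rho>] clopen unfolding connected_clopen
    by (metis closedin_closed_Int openin_open_Int)
  moreover have "0 \<in> ball 0 \<rho> \<inter> F ` ball 0 r"
    using F_eq[of 0] K0 \<rho> r by (auto intro!: image_eqI[of _ _ 0])
  ultimately have sub: "ball 0 \<rho> \<subseteq> F ` ball 0 r" by blast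
  define \<Omega> where "\<Omega> = F -` ball 0 \<rho> \<inter> ball 0 r"
  have \<Omega>: "open \<Omega>" "\<Omega> \<subseteq> ball 0 r" "F ` \<Omega> = ball 0 \<rho>"
    using cont(2) sub by (auto simp: \<Omega>_def continuous_on_open_vimage)
  have inj\<Omega>: "inj_on F \<Omega>" and cont\<Omega>: "continuous_on \<Omega> F"
    using inj cont(2) \<Omega>(2) inj_on_subset continuous_on_subset by blast+
  \<comment> \<open>\<open>\<Omega>\<close> is the image of the target disk under a continuous
    inverse \<open>g\<close>, hence connected.\<close>
  obtain g where "homeomorphism \<Omega> (F ` \<Omega>) F g"
    using invariance_of_domain_homeomorphism[OF \<Omega>(1) cont\<Omega> _ inj\<Omega>] by auto
  then have "connected \<Omega>"
    unfolding \<Omega>(3) homeomorphism_def using connected_continuous_image connected_ball by metis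
  moreover have "\<Omega> \<noteq> {}"
    using \<Omega>(3) \<rho> by (metis centre_in_ball empty_iff image_empty)
  ultimately show ?thesis
    unfolding contains_schlicht_disk_def \<rho>_def[symmetric]
    using \<Omega> inj\<Omega> by blast
qed

end

section \<open>Holomorphic functions as harmonic mappings\<close>

lemma holomorphic_wirtinger:
  assumes "f holomorphic_on S" "open S" "z \<in> S"
  shows "dz f z = deriv f z" and "dzbar f z = 0"
  using has_derivative_holomorphic_add_cnj[OF assms(1) holomorphic_on_const assms(2,3), of f 0]
    wirtinger_eqI[of f "deriv f z" 0 z] by auto

lemma harmonic_on_holomorphic:
  assumes f: "f holomorphic_on S" and S: "open S"
  shows "harmonic_on f S"
proof -
  have dz: "dz f differentiable at z" if z: "z \<in> S" for z
  proof -
    obtain D where D: "(deriv f has_derivative D) (at z)"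
      using holomorphic_deriv[OF f S] z S
      by (auto simp: holomorphic_on_def at_within_open[OF z S] field_differentiable_def has_field_derivative_def)
    have "(dz f has_derivative D) (at z)"
      by (rule has_derivative_transform_within_open[OF D S z]) (simp add: holomorphic_wirtinger[OF f S])
    then show ?thesis by (rule differentiableI)
  qed
  have dzbar: "(dzbar f has_derivative (\<lambda>v. 0 * v + 0 * cnj v)) (at z)" if z: "z \<in> S" for z
  proof -
    have "((\<lambda>z. 0) has_derivative (\<lambda>v. 0)) (at z)" by (rule has_derivative_const)
    from has_derivative_transform_within_open[OF this S z, of "dzbar f"] show ?thesis
      by (simp add: holomorphic_wirtinger[OF f S])
  qed
  have "f differentiable at z" if z: "z \<in> S" for z
    using has_derivative_holomorphic_add_cnj[OF f holomorphic_on_const S z, of f 0]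
    by (auto intro: differentiableI)
  with dz dzbar show ?thesis
    unfolding harmonic_on_def laplacian_def
    using wirtinger_eqI(1)[OF dzbar] by (auto intro: differentiableI)
qed

section \<open>The extremal mapping\<close>

definition extremal_harmonic :: "real \<Rightarrow> complex \<Rightarrow> complex" where
  "extremal_harmonic A z =
     of_real (A\<^sup>2) * z + of_real (A ^ 3 - A) * Ln (1 - z / of_real A)"

text \<open>On the real axis this is \<open>slope A\<close>, and up to the factor \<open>- A\<close>
  it is a disk automorphism: the equality case of Schwarz-Pick.\<close>

definition extremal_deriv :: "real \<Rightarrow> complex \<Rightarrow> complex" where
  "extremal_deriv A z = of_real A * ((1 / of_real A - z) / (1 - z / of_real A))"

text \<open>Keeps the argument of \<open>Ln\<close> off the branch cut and away from 0.\<close>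

lemma one_minus_divide_Re_pos:
  assumes "A > 1" "z \<in> ball 0 1"
  shows "Re (1 - z / of_real A) > 0"
proof -
  have "Re z < A" using assms complex_Re_le_cmod[of z] by simp
  then show ?thesis using assms by simp
qed

lemma extremal_harmonic_has_field_derivative:
  assumes A: "A > 1" and z: "z \<in> ball 0 1"
  shows "(extremal_harmonic A has_field_derivative extremal_deriv A z) (at z)"
proof -
  have re: "Re (1 - z / of_real A) > 0" using one_minus_divide_Re_pos[OF A z] .
  then have nz: "1 - z / of_real A \<noteq> 0" and nr: "1 - z / of_real A \<notin> \<real>\<^sub>\<le>\<^sub>0"
    by (auto simp: complex_nonpos_Reals_iff complex_eq_iff)
  have "((\<lambda>z. Ln (1 - z / of_real A)) has_field_derivative inverse (1 - z / of_real A) * (- 1 / of_real A)) (at z)"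
    by (rule DERIV_chain2[where f = Ln and g = "\<lambda>z. 1 - z / of_real A", OF has_field_derivative_Ln[OF nr]])
      (use A in \<open>auto intro!: derivative_eq_intros\<close>)
  then have "(extremal_harmonic A has_field_derivative
      of_real (A\<^sup>2) + of_real (A ^ 3 - A) * (inverse (1 - z / of_real A) * (- 1 / of_real A))) (at z)"
    unfolding extremal_harmonic_def[abs_def] by (intro DERIV_add DERIV_cmult_Id DERIV_cmult)
  also have "of_real (A\<^sup>2) + of_real (A ^ 3 - A) * (inverse (1 - z / of_real A) * (- 1 / of_real A)) = extremal_deriv A z"
  proof -
    have "of_real A - z \<noteq> 0" "complex_of_real A \<noteq> 0" using nz A by (auto simp: field_simps)
    moreover have "1 - z / of_real A = (of_real A - z) / of_real A" 
      using A by (simp add: field_simps)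
    ultimately show ?thesis
      unfolding extremal_deriv_def
      by (simp add: divide_simps) (simp add: algebra_simps power2_eq_square power3_eq_cube)
  qed
  finally show ?thesis .
qed

lemma norm_extremal_deriv_less:
  assumes "A > 1" "z \<in> ball 0 1"
  shows "norm (extremal_deriv A z) < A"
proof -
  have "- Moebius_function 0 (of_real (1 / A)) z = (1 / of_real A - z) / (1 - z / of_real A)"
    unfolding Moebius_function_simple minus_divide_left by simp
  then have "extremal_deriv A z = of_real A * (- Moebius_function 0 (of_real (1 / A)) z)"
    by (simp only: extremal_deriv_def)
  then have "norm (extremal_deriv A z) = A * norm (Moebius_function 0 (of_real (1 / A)) z)"
    using assms by (simp add: norm_mult)
  also have "\<dots> < A * 1"
    using assms by (intro mult_strict_left_mono Moebius_function_norm_lt_1) (auto simp: norm_divide)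
  finally show ?thesis by simp
qed

text \<open>\<open>extremal_harmonic A\<close> divided by \<open>A\<close> is a primitive of the
  integrand and vanishes at 0.\<close>

lemma extremal_eq:
  assumes A: "A > 1" and z: "z \<in> ball 0 1"
  shows "extremal A B z = extremal_harmonic A z - of_real B * z\<^sup>2 * cnj z"
proof -
  have "((\<lambda>\<zeta>. (1 / of_real A - \<zeta>) / (1 - \<zeta> / of_real A)) has_contour_integral
      (extremal_harmonic A (pathfinish (linepath 0 z)) / of_real A
       - extremal_harmonic A (pathstart (linepath 0 z)) / of_real A)) (linepath 0 z)"
  proof (rule contour_integral_primitive[where S = "ball 0 1" and f = "\<lambda>\<zeta>. extremal_harmonic A \<zeta> / of_real A"])
    fix \<zeta> :: complex assume \<zeta>: "\<zeta> \<in> ball 0 1"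
    have "((\<lambda>\<zeta>. extremal_harmonic A \<zeta> / of_real A) has_field_derivative extremal_deriv A \<zeta> / of_real A) (at \<zeta>)"
      by (intro DERIV_cdivide extremal_harmonic_has_field_derivative A \<zeta>)
    moreover have "extremal_deriv A \<zeta> / of_real A = (1 / of_real A - \<zeta>) / (1 - \<zeta> / of_real A)"
      unfolding extremal_deriv_def using A by (intro nonzero_mult_div_cancel_left) simp
    ultimately show "((\<lambda>\<zeta>. extremal_harmonic A \<zeta> / of_real A) has_field_derivative
        (1 / of_real A - \<zeta>) / (1 - \<zeta> / of_real A)) (at \<zeta> within ball 0 1)"
      by (metis has_field_derivative_at_within)
  next
    show "path_image (linepath 0 z) \<subseteq> ball 0 1"
      unfolding path_image_linepath using z by (intro closed_segment_subset convex_ball) auto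
  qed auto
  from contour_integral_unique[OF this] show ?thesis
    using A by (simp add: extremal_def extremal_harmonic_def)
qed

text \<open>The function \<open>- B * z\<close> is holomorphic, so it is logharmonic with
  \<open>a = 0\<close>, and |z|^2 times it is the term
  \<open>- B * z\<^sup>2 * cnj z\<close>.\<close>

lemma landau_extremal:
  assumes A: "A > 1" and B: "B \<ge> 0"
  shows "landau A B (extremal A B) (\<lambda>z. - of_real B * z) (extremal_harmonic A)"
proof -
  let ?L = "\<lambda>z. - of_real B * z :: complex"
  have K: "extremal_harmonic A holomorphic_on ball 0 1"
    using extremal_harmonic_has_field_derivative[OF A] by (intro holomorphic_onI) 
     (auto simp: field_differentiable_def intro: has_field_derivative_at_within)
  have derK: "deriv (extremal_harmonic A) z = extremal_deriv A z" if "z \<in> ball 0 1" for z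
    using extremal_harmonic_has_field_derivative[OF A that] by (rule DERIV_imp_deriv)
  have L: "?L holomorphic_on UNIV" by (intro holomorphic_intros)
  have derL: "deriv ?L z = - of_real B" for z
    by (rule DERIV_imp_deriv) (auto intro!: derivative_eq_intros)
  have split: "extremal A B z = of_real ((norm z)\<^sup>2) * ?L z + extremal_harmonic A z" if "z \<in> ball 0 1" for z
    unfolding extremal_eq[OF A that] complex_norm_square by (simp add: power2_eq_square algebra_simps)
  have "logharmonic_on ?L (ball 0 1)"
    unfolding logharmonic_on_def
    by (intro conjI exI[of _ "\<lambda>z. 0"] ballI) (auto simp: holomorphic_wirtinger[OF L open_UNIV])
  moreover have "\<exists>h\<^sub>1 g\<^sub>1 h\<^sub>2 g\<^sub>2.
      h\<^sub>1 holomorphic_on ball 0 1 \<and> g\<^sub>1 holomorphic_on ball 0 1 \<and>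
      h\<^sub>2 holomorphic_on ball 0 1 \<and> g\<^sub>2 holomorphic_on ball 0 1 \<and>
      (\<forall>z\<in>ball 0 1. ?L z = h\<^sub>1 z * cnj (g\<^sub>1 z)) \<and>
      (\<forall>z\<in>ball 0 1. extremal_harmonic A z = h\<^sub>2 z + cnj (g\<^sub>2 z))"
    using K holomorphic_on_subset[OF L subset_UNIV]
    by - (rule exI[of _ ?L], rule exI[of _ "\<lambda>z. 1"], rule exI[of _ "extremal_harmonic A"],
      rule exI[of _ "\<lambda>z. 0"], simp)
  ultimately have "logharmonic_laplacian (extremal A B) ?L (extremal_harmonic A)"
    unfolding logharmonic_laplacian_def using split harmonic_on_holomorphic[OF K open_ball] by blast
  \<comment> \<open>The cubic term has zero derivative at 0, and \<open>extremal_deriv A 0\<close>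
    is 1.\<close>
  moreover have "small_lambda (extremal A B) 0 = 1"
  proof -
    have "(extremal_harmonic A has_derivative (*) 1) (at 0)"
      using extremal_harmonic_has_field_derivative[OF A, of 0] A
      by (simp add: extremal_deriv_def has_field_derivative_def)
    then have "((\<lambda>z. extremal_harmonic A z - of_real B * z\<^sup>2 * cnj z) has_derivative (\<lambda>v. 1 * v + 0 * cnj v)) (at 0)"
      by (auto intro!: derivative_eq_intros)
    then have "(extremal A B has_derivative (\<lambda>v. 1 * v + 0 * cnj v)) (at 0)"
      by (rule has_derivative_transform_within_open[of _ _ _ _ "ball 0 1"]) (auto simp: extremal_eq[OF A])
    from wirtinger_eqI[OF this] show ?thesis by (simp add: small_lambda_def)
  qed
  moreover have "big_Lambda (extremal_harmonic A) z < A" if "z \<in> ball 0 1" for z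
    using norm_extremal_deriv_less[OF A that]
    by (simp add: big_Lambda_def holomorphic_wirtinger[OF K open_ball that] derK[OF that])
  moreover have "big_Lambda ?L z \<le> B" for z
    unfolding big_Lambda_def holomorphic_wirtinger[OF L open_UNIV UNIV_I] derL using B by simp
  moreover have "extremal A B 0 = 0"
    using extremal_eq[OF A, of 0] by (simp add: extremal_harmonic_def)
  ultimately show ?thesis using A by unfold_locales (auto simp: landau_hypotheses_def)
qed

section \<open>Sharpness of both constants\<close>

text \<open>Reduces sharpness to a real function whose derivative is
  \<open>net_slope A B\<close>.\<close>

lemma extremal_of_real:
  assumes A: "A > 1" and x: "\<bar>x\<bar> < 1"
  shows "extremal A B (of_real x) = of_real (profile A x - x ^ 3 * B)"
proof -
  have "x / A < 1" using A x by (simp add: field_simps)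
  then have "Ln (1 - of_real x / of_real A) = of_real (ln (1 - x / A))"
    using Ln_of_real[of "1 - x / A"] by simp
  then show ?thesis using extremal_eq[OF A, of "of_real x"] x
    by (simp add: extremal_harmonic_def profile_def power2_eq_square power3_eq_cube algebra_simps)
qed

text \<open>On the real axis the extremal mapping folds back at the zero of its derivative.\<close>

lemma extremal_not_inj_on:
  assumes A: "A > 1" and B: "B \<ge> 0" and r: "0 < r" "net_slope A B r = 0"
    and s: "r < s" "s \<le> 1"
  shows "\<not> inj_on (extremal A B) (ball 0 s)"
proof
  assume inj: "inj_on (extremal A B) (ball 0 s)"
  let ?N = "\<lambda>x. profile A x - x ^ 3 * B"
  \<comment> \<open>Lies past the zero of the derivative, inside the ball of radius
    \<open>s\<close>, and below 1 even if \<open>s\<close> is 1.\<close>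
  define t where "t = (r + s) / 2"
  have t: "r < t" "t < s" "t < 1" using s by (auto simp: t_def)
  have neq: "?N x \<noteq> ?N y" if "0 \<le> x" "x < y" "y \<le> t" for x y
  proof
    assume N: "?N x = ?N y"
    have "\<bar>x\<bar> < 1" "\<bar>y\<bar> < 1" using that t by auto
    then have "extremal A B (of_real x) = extremal A B (of_real y)"
      by (simp only: extremal_of_real[OF A] N)
    from inj_onD[OF inj this] show False using that t by auto
  qed
  have cont: "continuous_on {a..b} ?N" if "b \<le> t" for a b
    by (rule DERIV_atLeastAtMost_imp_continuous_on, rule exI, rule net_profile_has_derivative)
      (use that A t in auto)
  have "?N t < ?N r"
  proof (rule DERIV_neg_imp_decreasing_open[of r t ?N])
    show "\<exists>y. (?N has_real_derivative y) (at x) \<and> y < 0" if "r < x" "x < t" for x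
      using that A r t net_profile_has_derivative[of A x B] net_slope_strict_decreasing[OF A B, of r x] by auto
  qed (use t cont in auto)
  moreover have "?N 0 < ?N r"
    using net_profile_pos[OF A B r(1) _ r(2)] t by (simp add: profile_def)
  \<comment> \<open>The value at \<open>r\<close> exceeds those at 0 and at \<open>t\<close>, so the
    larger of these two end values is taken again on the other side of \<open>r\<close>.\<close>
  ultimately show False
  proof (cases "?N 0 \<le> ?N t")
    case True
    then obtain x where "0 \<le> x" "x \<le> r" "?N x = ?N t"
      using IVT'[of ?N 0 "?N t" r] \<open>?N t < ?N r\<close> cont[of r 0] r t by auto
    then show False using neq[of x t] t by auto
  next
    case False
    then obtain x where "r \<le> x" "x \<le> t" "?N x = ?N 0"
      using IVT2'[of ?N t "?N 0" r] \<open>?N 0 < ?N r\<close> cont[of t r] t by auto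
    then show False using neq[of 0 x] r by auto
  qed
qed

text \<open>The boundary point \<open>r\<close> is mapped to the real number
  \<open>profile A r - r ^ 3 * B\<close>, which any larger disk contains; injectivity on the closed
  disk keeps that value out of the image of the open one.\<close>

lemma extremal_image_no_larger_disk:
  assumes A: "A > 1" and B: "B \<ge> 0" and r: "0 < r" "r < 1" "net_slope A B r = 0"
    and \<rho>: "profile A r - r ^ 3 * B < \<rho>"
  shows "\<not> ball 0 \<rho> \<subseteq> extremal A B ` ball 0 r"
proof
  assume "ball 0 \<rho> \<subseteq> extremal A B ` ball 0 r"
  moreover have "extremal A B (of_real r) \<in> ball 0 \<rho>"
    using extremal_of_real[OF A, of r B] net_profile_pos[OF A B r] \<rho> r by (simp del: of_real_diff of_real_mult)
  ultimately obtain z where z: "z \<in> ball 0 r" "extremal A B (of_real r) = extremal A B z" by auto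
  have "inj_on (extremal A B) (cball 0 r)"
    using landau.inj_on_cball[OF landau_extremal[OF A B] r(2,3)] .
  from inj_onD[OF this z(2)] z(1) r show False by auto
qed

theorem theorem3p1:
  fixes \<Lambda>\<^sub>1 \<Lambda>\<^sub>2 :: real
  assumes "\<Lambda>\<^sub>1 > 1" and "\<Lambda>\<^sub>2 \<ge> 0"
  shows "\<exists>r\<^sub>1 \<rho>\<^sub>1 :: real.
    0 < r\<^sub>1 \<and> r\<^sub>1 < 1 \<and>
    \<Lambda>\<^sub>1 * ((1 - \<Lambda>\<^sub>1 * r\<^sub>1) / (\<Lambda>\<^sub>1 - r\<^sub>1)) - 3 * r\<^sub>1\<^sup>2 * \<Lambda>\<^sub>2 = 0 \<and>
    \<rho>\<^sub>1 = \<Lambda>\<^sub>1\<^sup>2 * r\<^sub>1 + (\<Lambda>\<^sub>1 ^ 3 - \<Lambda>\<^sub>1) * ln (1 - r\<^sub>1 / \<Lambda>\<^sub>1) - r\<^sub>1 ^ 3 * \<Lambda>\<^sub>2 \<and>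
    0 < \<rho>\<^sub>1 \<and>
    (\<forall>F L K. landau_hypotheses \<Lambda>\<^sub>1 \<Lambda>\<^sub>2 F L K \<and> L 0 = 0 \<longrightarrow>
       inj_on F (ball 0 r\<^sub>1) \<and> contains_schlicht_disk F (ball 0 r\<^sub>1) (ball 0 \<rho>\<^sub>1)) \<and>
    (\<forall>z\<in>ball 0 1. extremal \<Lambda>\<^sub>1 \<Lambda>\<^sub>2 z =
       of_real (\<Lambda>\<^sub>1\<^sup>2) * z + of_real (\<Lambda>\<^sub>1 ^ 3 - \<Lambda>\<^sub>1) * Ln (1 - z / of_real \<Lambda>\<^sub>1)
         - of_real \<Lambda>\<^sub>2 * z\<^sup>2 * cnj z) \<and>
    (\<exists>L K. landau_hypotheses \<Lambda>\<^sub>1 \<Lambda>\<^sub>2 (extremal \<Lambda>\<^sub>1 \<Lambda>\<^sub>2) L K \<and> L 0 = 0) \<and>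
    (\<forall>r. r\<^sub>1 < r \<and> r \<le> 1 \<longrightarrow> \<not> inj_on (extremal \<Lambda>\<^sub>1 \<Lambda>\<^sub>2) (ball 0 r)) \<and>
    (\<forall>\<rho>. \<rho>\<^sub>1 < \<rho> \<longrightarrow> \<not> ball 0 \<rho> \<subseteq> extremal \<Lambda>\<^sub>1 \<Lambda>\<^sub>2 ` ball 0 r\<^sub>1)"
proof -
  note A = assms(1) and B = assms(2)
  obtain r where r: "0 < r" "r < 1" "net_slope \<Lambda>\<^sub>1 \<Lambda>\<^sub>2 r = 0"
    using net_slope_zero[OF A B] .
  have main: "inj_on F (ball 0 r) \<and> contains_schlicht_disk F (ball 0 r) (ball 0 (profile \<Lambda>\<^sub>1 r - r ^ 3 * \<Lambda>\<^sub>2))"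
    if "landau_hypotheses \<Lambda>\<^sub>1 \<Lambda>\<^sub>2 F L K \<and> L 0 = 0" for F L K
  proof -
    interpret landau \<Lambda>\<^sub>1 \<Lambda>\<^sub>2 F L K using that A by unfold_locales auto
    show ?thesis using inj_on_subset[OF inj_on_cball[OF r(2,3)] ball_subset_cball] schlicht_disk[OF r] by blast
  qed
  interpret extremal: landau \<Lambda>\<^sub>1 \<Lambda>\<^sub>2 "extremal \<Lambda>\<^sub>1 \<Lambda>\<^sub>2" "\<lambda>z. - of_real \<Lambda>\<^sub>2 * z" "extremal_harmonic \<Lambda>\<^sub>1"
    by (rule landau_extremal[OF A B])
  show ?thesis
  proof (rule exI[of _ r], rule exI[of _ "profile \<Lambda>\<^sub>1 r - r ^ 3 * \<Lambda>\<^sub>2"], intro conjI)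
    show "\<Lambda>\<^sub>1 * ((1 - \<Lambda>\<^sub>1 * r) / (\<Lambda>\<^sub>1 - r)) - 3 * r\<^sup>2 * \<Lambda>\<^sub>2 = 0"
      using r(3) by (simp add: net_slope_def slope_def)
    show "profile \<Lambda>\<^sub>1 r - r ^ 3 * \<Lambda>\<^sub>2 = \<Lambda>\<^sub>1\<^sup>2 * r + (\<Lambda>\<^sub>1 ^ 3 - \<Lambda>\<^sub>1) * ln (1 - r / \<Lambda>\<^sub>1) - r ^ 3 * \<Lambda>\<^sub>2"
      by (simp add: profile_def)
    show "0 < profile \<Lambda>\<^sub>1 r - r ^ 3 * \<Lambda>\<^sub>2" by (rule net_profile_pos[OF A B r])
    show "\<forall>z\<in>ball 0 1. extremal \<Lambda>\<^sub>1 \<Lambda>\<^sub>2 z =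
       of_real (\<Lambda>\<^sub>1\<^sup>2) * z + of_real (\<Lambda>\<^sub>1 ^ 3 - \<Lambda>\<^sub>1) * Ln (1 - z / of_real \<Lambda>\<^sub>1)
         - of_real \<Lambda>\<^sub>2 * z\<^sup>2 * cnj z"
      using extremal_eq[OF A] unfolding extremal_harmonic_def by blast
    show "\<exists>L K. landau_hypotheses \<Lambda>\<^sub>1 \<Lambda>\<^sub>2 (extremal \<Lambda>\<^sub>1 \<Lambda>\<^sub>2) L K \<and> L 0 = 0"
      using extremal.hyps extremal.L0 by blast
    show "\<forall>s. r < s \<and> s \<le> 1 \<longrightarrow> \<not> inj_on (extremal \<Lambda>\<^sub>1 \<Lambda>\<^sub>2) (ball 0 s)"
      using extremal_not_inj_on[OF A B r(1,3)] by blast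
    show "\<forall>\<rho>. profile \<Lambda>\<^sub>1 r - r ^ 3 * \<Lambda>\<^sub>2 < \<rho> \<longrightarrow> \<not> ball 0 \<rho> \<subseteq> extremal \<Lambda>\<^sub>1 \<Lambda>\<^sub>2 ` ball 0 r"
      using extremal_image_no_larger_disk[OF A B r] by blast
  qed (use r main in auto)
qed

end
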